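(* Let $d\ge 1$ and suppose $\phi(x_1,\dots,x_d)\in\mathbb{C}\{x_1,\dots,x_d\}$, i.e. $\phi$ is analytic near $0\in\mathbb{C}^d$. Assume $\phi(0)=0$ and that $z+\phi(x)$ has no zeros for $z\in\mathbb{H}$ and $x\in\mathbb{H}^d$ sufficiently close to $0$. Then $\nabla\phi(0)\in[0,\infty)^d$ and $\operatorname{Im}\phi$ is non-negative on a neighborhood of $0$ within $\mathbb{R}^d$. In addition, either: (i) $\phi\in\mathbb{R}\{x_1,\dots,x_d\}$, i.e. $\phi$ has all real coefficients; or (ii) there is an integer $L\ge 1$ such that $\phi$ has the form $$\phi(x)=\phi_1(x)+\cdots+\phi_{2L-1}(x)+\phi_{2L}(x)+\cdots$$ where each $\phi_j$ is a homogeneous polynomial of degree $j$, the polynomials $\phi_1,\dots,\phi_{2L-1}\in\mathbb{R}[x_1,\dots,x_d]$ have real coefficients, and $\operatorname{Im}\phi_{2L}\not\equiv 0$ is non-negative on $\mathbb{R}^d$. Furthermore, if $T\subset\{1,\dots,d\}$ is the set of indices $j$ for which the $j$-th component of $\nabla\phi(0)$ is zero, then $\phi\big(\sum_{j\in T}x_je_j\big)\equiv 0$, where $e_1,\dots,e_d$ are the standard basis vectors of $\mathbb{C}^d$.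
   Context: $\mathbb{H}=\{z\in\mathbb{C}:\operatorname{Im}z>0\}$ is the open upper half-plane. $\mathbb{C}\{x_1,\dots,x_d\}$ (resp. $\mathbb{R}\{x_1,\dots,x_d\}$) is the ring of power series with complex (resp. real) coefficients convergent in a neighborhood of $0$. For $f\in\mathbb{C}\{x_1,\dots,x_d\}$, $\operatorname{Im} f$ denotes the analytic function obtained by taking the imaginary parts of the coefficients of $f$, namely $(\operatorname{Im} f)(x)=\frac{1}{2i}\big(f(x)-\overline{f(\bar x)}\big)$; it agrees with the pointwise imaginary part of $f(x)$ for $x\in\mathbb{R}^d$. *)

theory Defs
  imports "HOL-Analysis.Analysis"
begin

text \<open>
  A power series in the variables \<open>x\<^sub>i\<close>, where \<open>i\<close> ranges over a finite index type \<open>'d\<close>, is the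
  family of its coefficients, indexed by the exponent vectors \<open>\<alpha> :: 'd \<Rightarrow> nat\<close>. Polynomials are the
  families of finite support. The number of variables is \<open>d = CARD('d) \<ge> 1\<close>.
\<close>

type_synonym 'd mseries = "('d \<Rightarrow> nat) \<Rightarrow> complex"

definition mterm :: "'d::finite mseries \<Rightarrow> complex ^ 'd \<Rightarrow> ('d \<Rightarrow> nat) \<Rightarrow> complex" where
  "mterm f x \<alpha> = f \<alpha> * (\<Prod>i\<in>UNIV. x $ i ^ \<alpha> i)"

text \<open>Outside the domain of convergence \<open>meval\<close> has a meaningless value, so it is only to be used
  near \<open>0\<close>, or for polynomials.\<close>

definition meval :: "'d::finite mseries \<Rightarrow> complex ^ 'd \<Rightarrow> complex" where
  "meval f x = (\<Sum>\<^sub>\<infinity>\<alpha>. mterm f x \<alpha>)"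

definition conv_series :: "'d::finite mseries set" where
  "conv_series = {f. \<forall>\<^sub>F x in nhds 0. mterm f x summable_on UNIV}"

definition real_conv_series :: "'d::finite mseries set" where
  "real_conv_series = {f \<in> conv_series. \<forall>\<alpha>. f \<alpha> \<in> \<real>}"

definition real_polys :: "'d::finite mseries set" where
  "real_polys = {p. finite {\<alpha>. p \<alpha> \<noteq> 0} \<and> (\<forall>\<alpha>. p \<alpha> \<in> \<real>)}"

definition homogeneous_polys :: "nat \<Rightarrow> 'd::finite mseries set" where
  "homogeneous_polys n =
     {p. finite {\<alpha>. p \<alpha> \<noteq> 0} \<and> (\<forall>\<alpha>. p \<alpha> \<noteq> 0 \<longrightarrow> (\<Sum>i\<in>UNIV. \<alpha> i) = n)}"

definition Im_series :: "'d::finite mseries \<Rightarrow> 'd mseries" where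
  "Im_series f = (\<lambda>\<alpha>. complex_of_real (Im (f \<alpha>)))"

definition upper_half_plane :: "complex set" where
  "upper_half_plane = {z. Im z > 0}"

definition cvec :: "real ^ 'd \<Rightarrow> complex ^ 'd" where
  "cvec x = (\<chi> i. complex_of_real (x $ i))"

definition cgradient :: "(complex ^ 'd \<Rightarrow> complex) \<Rightarrow> complex ^ 'd \<Rightarrow> complex ^ 'd" where
  "cgradient F p = (\<chi> j. deriv (\<lambda>t. F (p + axis j t)) 0)"

end

theory Submission
  imports Defs "HOL-Computational_Algebra.Polynomial"
begin

text \<open>
  If \<open>Im \<phi>(x) < 0\<close> at a small point \<open>x\<close> of \<open>\<H>\<^sup>d\<close>, then \<open>z = -\<phi>(x)\<close> is a small point of \<open>\<H>\<close> with
  \<open>z + \<phi>(x) = 0\<close>. So the absence of zeros says that \<open>Im \<phi> \<ge> 0\<close> on \<open>\<H>\<^sup>d\<close> near \<open>0\<close>, and by continuity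
  on its closure (\<open>pick_germ_of_zero_free\<close>), which contains the real points. Everything else comes
  from this inequality on rays.

  Write \<open>\<phi>\<^sub>k\<close> for the homogeneous part of degree \<open>k\<close>, so that \<open>\<phi>(t v) = \<Sum>\<^sub>k t\<^sup>k \<phi>\<^sub>k(v)\<close>. Put \<open>t = s \<omega>\<close> with
  \<open>s > 0\<close> small. If \<open>\<omega> v\<close> lies in the closure of \<open>\<H>\<^sup>d\<close>, then \<open>\<Sum>\<^sub>k s\<^sup>k Im (\<omega>\<^sup>k \<phi>\<^sub>k(v)) \<ge> 0\<close>, so the first
  coefficient of this real power series that does not vanish is positive (\<open>ray_leading_Im_nonneg\<close>).
  The conclusions follow from three choices of \<open>v\<close> and \<open>\<omega>\<close>.

  \<^item> For \<open>v = e\<^sub>j\<close> the coefficient of \<open>s\<close> is \<open>Im (\<omega> a)\<close> with \<open>a = \<partial>\<^sub>j\<phi>(0)\<close>, and \<open>\<omega> = 1, -1, \<i>\<close> give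
    \<open>a \<ge> 0\<close>.

  \<^item> For \<open>v\<close> real and \<open>\<omega> = 1, -1\<close>, let \<open>m\<close> be the least degree in which \<open>\<phi>\<close> has a nonreal coefficient.
    Then \<open>Im \<phi>\<^sub>m(v) \<ge> 0\<close> and \<open>(-1)\<^sup>m Im \<phi>\<^sub>m(v) \<ge> 0\<close>. An odd \<open>m\<close> would force \<open>Im \<phi>\<^sub>m = 0\<close>, hence
    \<open>m = 2L\<close> (\<open>first_nonreal_part\<close>).

  \<^item> For \<open>v\<close> with positive entries on \<open>T\<close> and zeros elsewhere, \<open>\<phi>\<^sub>0(v) = \<phi>\<^sub>1(v) = 0\<close>. If \<open>\<phi>\<^sub>k(v)\<close> were the
    first nonzero term, then \<open>k \<ge> 2\<close>, and as \<open>\<omega>\<close> runs through the upper half-circle, \<open>\<omega>\<^sup>k\<close> covers the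
    whole circle, so \<open>\<omega>\<^sup>k \<phi>\<^sub>k(v)\<close> would be negative imaginary for some \<open>\<omega>\<close>. So every \<open>\<phi>\<^sub>k\<close> vanishes on
    an orthant of the coordinate subspace of \<open>T\<close> (\<open>homogeneous_parts_real_nonneg_vanish\<close>), and
    its coefficients supported on \<open>T\<close> are zero (\<open>poly_vanishing_on_orthant\<close>).
\<close>

section \<open>Polynomial identities on an orthant\<close>

abbreviation mdeg :: "('d::finite \<Rightarrow> nat) \<Rightarrow> nat" where
  "mdeg \<alpha> \<equiv> (\<Sum>i\<in>UNIV. \<alpha> i)"

lemma finite_mdeg_eq: "finite {\<alpha> :: 'd::finite \<Rightarrow> nat. mdeg \<alpha> = n}"
proof (rule finite_subset)
  show "{\<alpha> :: 'd \<Rightarrow> nat. mdeg \<alpha> = n} \<subseteq> (\<Pi>\<^sub>E i\<in>UNIV. {..n})"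
    by (auto simp: PiE_UNIV_domain intro!: member_le_sum)
qed (auto intro: finite_PiE)

text \<open>Positional notation: once \<open>w\<close> separates the exponents on \<open>S\<close>, the weight of a new index \<open>j\<close> is chosen
  larger than every weighted sum over \<open>S\<close>, so that \<open>\<alpha> j\<close> is recovered by division.\<close>

lemma separating_weights_on:
  fixes A :: "('d \<Rightarrow> nat) set"
  assumes "finite S" "finite A"
  shows "\<exists>w. \<forall>\<alpha>\<in>A. \<forall>\<beta>\<in>A. (\<Sum>i\<in>S. w i * \<alpha> i) = (\<Sum>i\<in>S. w i * \<beta> i) \<longrightarrow> (\<forall>i\<in>S. \<alpha> i = \<beta> i)"
  using assms(1)
proof (induction S)
  case empty
  then show ?case by simp
next
  case (insert j S)
  then obtain w where w: "\<And>\<alpha> \<beta>. \<alpha> \<in> A \<Longrightarrow> \<beta> \<in> A \<Longrightarrow>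
      (\<Sum>i\<in>S. w i * \<alpha> i) = (\<Sum>i\<in>S. w i * \<beta> i) \<Longrightarrow> (\<forall>i\<in>S. \<alpha> i = \<beta> i)"
    by blast
  define N where "N = Suc (\<Sum>\<alpha>\<in>A. \<Sum>i\<in>S. w i * \<alpha> i)"
  have N: "(\<Sum>i\<in>S. w i * \<alpha> i) < N" if "\<alpha> \<in> A" for \<alpha>
    unfolding N_def using \<open>finite A\<close> that
    by (intro le_imp_less_Suc member_le_sum[where f = "\<lambda>\<alpha>. \<Sum>i\<in>S. w i * \<alpha> i"]) auto
  have split: "(\<Sum>i\<in>insert j S. (w(j := N)) i * \<alpha> i) = N * \<alpha> j + (\<Sum>i\<in>S. w i * \<alpha> i)" for \<alpha>
    using insert.hyps by (auto intro!: sum.cong)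
  show ?case
  proof (intro exI[of _ "w(j := N)"] ballI impI)
    fix \<alpha> \<beta> i
    assume *: "\<alpha> \<in> A" "\<beta> \<in> A"
      "(\<Sum>i\<in>insert j S. (w(j := N)) i * \<alpha> i) = (\<Sum>i\<in>insert j S. (w(j := N)) i * \<beta> i)"
      and i: "i \<in> insert j S"
    have eq: "N * \<alpha> j + (\<Sum>i\<in>S. w i * \<alpha> i) = N * \<beta> j + (\<Sum>i\<in>S. w i * \<beta> i)"
      using *(3) unfolding split .
    have "\<alpha> j = (N * \<alpha> j + (\<Sum>i\<in>S. w i * \<alpha> i)) div N"
      using N[OF *(1)] by simp
    also have "\<dots> = \<beta> j"
      unfolding eq using N[OF *(2)] by simp
    finally have "\<alpha> j = \<beta> j" .
    with eq w[OF *(1,2)] i show "\<alpha> i = \<beta> i" by auto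
  qed
qed

text \<open>The substitution \<open>x\<^sub>i = r\<^bsup>w\<^sub>i\<^esup>\<close> with separating weights \<open>w\<close> (Kronecker) turns distinct monomials
  into distinct powers of \<open>r\<close>, so that the claim reduces to a polynomial in one variable with
  infinitely many roots. Putting \<open>x\<^sub>i = 0\<close> off \<open>S\<close> removes the monomials that are not supported on \<open>S\<close>.\<close>

lemma poly_vanishing_on_orthant:
  fixes c :: "('d::finite \<Rightarrow> nat) \<Rightarrow> complex"
  assumes "finite A"
    and vanish: "\<And>x :: real ^ 'd. (\<forall>i. if i \<in> S then x $ i > 0 else x $ i = 0) \<Longrightarrow>
           (\<Sum>\<alpha>\<in>A. mterm c (cvec x) \<alpha>) = 0"
    and \<alpha>: "\<alpha> \<in> A" "\<And>i. i \<notin> S \<Longrightarrow> \<alpha> i = 0"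
  shows "c \<alpha> = 0"
proof -
  obtain w where w: "\<And>\<alpha> \<beta>. \<alpha> \<in> A \<Longrightarrow> \<beta> \<in> A \<Longrightarrow>
      (\<Sum>i\<in>UNIV. w i * \<alpha> i) = (\<Sum>i\<in>UNIV. w i * \<beta> i) \<Longrightarrow> (\<forall>i. \<alpha> i = \<beta> i)"
    using separating_weights_on[OF finite[of UNIV] \<open>finite A\<close>] by blast
  define e where "e \<alpha> = (\<Sum>i\<in>UNIV. w i * \<alpha> i)" for \<alpha>
  have e_inj: "\<alpha> = \<beta>" if "\<alpha> \<in> A" "\<beta> \<in> A" "e \<alpha> = e \<beta>" for \<alpha> \<beta>
    using w[OF that(1,2)] that(3) by (auto simp: e_def)
  define B where "B = {\<beta> \<in> A. \<forall>i. i \<notin> S \<longrightarrow> \<beta> i = 0}"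
  have B: "finite B" "B \<subseteq> A" using \<open>finite A\<close> by (auto simp: B_def)
  define q where "q = (\<Sum>\<beta>\<in>B. monom (c \<beta>) (e \<beta>))"
  have root: "poly q (of_real r) = 0" if "r > 0" for r :: real
  proof -
    define x :: "real ^ 'd" where "x = (\<chi> i. if i \<in> S then r ^ w i else 0)"
    have off: "mterm c (cvec x) \<beta> = 0" if "\<beta> \<in> A - B" for \<beta>
    proof -
      from that obtain i where "i \<notin> S" "\<beta> i \<noteq> 0" by (auto simp: B_def)
      then have "(\<Prod>i\<in>UNIV. cvec x $ i ^ \<beta> i) = 0"
        by (intro prod_zero) (auto simp: x_def cvec_def intro!: exI[of _ i])
      then show ?thesis by (simp add: mterm_def)
    qed
    have on: "mterm c (cvec x) \<beta> = c \<beta> * of_real r ^ e \<beta>" if "\<beta> \<in> B" for \<beta>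
    proof -
      have "cvec x $ i ^ \<beta> i = of_real r ^ (w i * \<beta> i)" for i
        using that by (auto simp: x_def cvec_def B_def power_mult)
      then show ?thesis by (simp add: mterm_def e_def power_sum)
    qed
    have "poly q (of_real r) = (\<Sum>\<beta>\<in>B. mterm c (cvec x) \<beta>)"
      by (simp add: q_def poly_sum poly_monom on)
    also have "\<dots> = (\<Sum>\<beta>\<in>A. mterm c (cvec x) \<beta>)"
      by (intro sum.mono_neutral_left \<open>finite A\<close> B ballI off)
    also have "\<dots> = 0"
      using that by (intro vanish) (auto simp: x_def)
    finally show ?thesis .
  qed
  have "q = 0"
  proof (rule ccontr)
    assume "q \<noteq> 0"
    then have "finite (complex_of_real ` {0<..})"
      by (rule finite_subset[OF _ poly_roots_finite, rotated]) (auto simp: root)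
    then have "finite {0::real<..}"
      by (rule finite_imageD) (auto simp: inj_on_def)
    then show False using infinite_Ioi by blast
  qed
  then have "0 = coeff q (e \<alpha>)" by simp
  also have "\<dots> = (\<Sum>\<beta>\<in>B. if \<beta> = \<alpha> then c \<beta> else 0)"
    unfolding q_def coeff_sum using B e_inj \<alpha>(1) by (intro sum.cong) auto
  also have "\<dots> = c \<alpha>"
    using B \<alpha> by (simp add: B_def)
  finally show ?thesis by simp
qed

section \<open>Convergent power series and their homogeneous parts\<close>

definition hpart :: "nat \<Rightarrow> 'd::finite mseries \<Rightarrow> 'd mseries" where
  "hpart k f = (\<lambda>\<alpha>. if mdeg \<alpha> = k then f \<alpha> else 0)"

lemma hpart_homogeneous: "hpart k f \<in> homogeneous_polys k"
proof -
  have "{\<alpha>. hpart k f \<alpha> \<noteq> 0} \<subseteq> {\<alpha>. mdeg \<alpha> = k}"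
    by (auto simp: hpart_def)
  then have "finite {\<alpha>. hpart k f \<alpha> \<noteq> 0}"
    by (rule finite_subset) (rule finite_mdeg_eq)
  then show ?thesis by (simp add: homogeneous_polys_def) (simp add: hpart_def)
qed

lemma mterm_hpart_has_sum:
  "(mterm (hpart k f) x has_sum (\<Sum>\<alpha> | mdeg \<alpha> = k. mterm f x \<alpha>)) UNIV"
proof -
  have "(mterm f x has_sum (\<Sum>\<alpha> | mdeg \<alpha> = k. mterm f x \<alpha>)) {\<alpha>. mdeg \<alpha> = k}"
    by (simp add: finite_mdeg_eq)
  also have "?this \<longleftrightarrow> ?thesis"
    by (rule has_sum_cong_neutral) (auto simp: mterm_def hpart_def)
  finally show ?thesis .
qed

lemma meval_hpart: "meval (hpart k f) x = (\<Sum>\<alpha> | mdeg \<alpha> = k. mterm f x \<alpha>)"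
  unfolding meval_def by (rule infsumI) (rule mterm_hpart_has_sum)

lemma meval_hpart_smult: "meval (hpart k f) (t *s x) = t ^ k * meval (hpart k f) x"
  by (auto simp: meval_hpart sum_distrib_left mterm_def power_mult_distrib prod.distrib
      power_sum[symmetric] intro!: sum.cong)

lemma hpart_0: "meval (hpart 0 f) x = f (\<lambda>_. 0)"
proof -
  have "{\<alpha> :: 'a \<Rightarrow> nat. mdeg \<alpha> = 0} = {\<lambda>_. 0}" by auto
  then show ?thesis by (simp add: meval_hpart mterm_def)
qed

lemma meval_0: "meval f 0 = f (\<lambda>_. 0)"
proof -
  have "mterm f 0 \<alpha> = 0" if "\<alpha> \<noteq> (\<lambda>_. 0)" for \<alpha>
  proof -
    from that obtain i where "\<alpha> i \<noteq> 0" by auto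
    then have "(\<Prod>i\<in>UNIV. (0 :: complex ^ 'a) $ i ^ \<alpha> i) = 0"
      by (intro prod_zero) (auto intro!: exI[of _ i])
    then show ?thesis by (simp add: mterm_def)
  qed
  then have "(mterm f 0 has_sum mterm f 0 (\<lambda>_. 0)) UNIV"
    by (intro has_sum_finite_neutralI[of "{\<lambda>_. 0}"]) auto
  moreover have "mterm f 0 (\<lambda>_. 0) = f (\<lambda>_. 0)"
    by (simp add: mterm_def)
  ultimately show ?thesis by (simp add: meval_def infsumI)
qed

lemma homogeneous_expansion:
  assumes "mterm f x summable_on UNIV"
  shows "(\<lambda>k. meval (hpart k f) x) sums meval f x"
proof -
  have "((\<lambda>(k, \<alpha>). mterm f x \<alpha>) has_sum meval f x) (SIGMA k:UNIV. {\<alpha>. mdeg \<alpha> = k}) \<longleftrightarrow>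
      (mterm f x has_sum meval f x) UNIV"
    by (rule has_sum_reindex_bij_witness[of _ "\<lambda>\<alpha>. (mdeg \<alpha>, \<alpha>)" snd]) auto
  moreover have "(mterm f x has_sum meval f x) UNIV"
    using assms by (simp add: meval_def)
  ultimately have "((\<lambda>(k, \<alpha>). mterm f x \<alpha>) has_sum meval f x) (SIGMA k:UNIV. {\<alpha>. mdeg \<alpha> = k})"
    by simp
  then have "((\<lambda>k. meval (hpart k f) x) has_sum meval f x) UNIV"
    by (rule has_sum_SigmaD) (simp add: meval_hpart finite_mdeg_eq)
  then show ?thesis by (rule has_sum_imp_sums)
qed

lemma Im_series_hpart: "Im_series (hpart k f) = hpart k (Im_series f)"
  by (auto simp: Im_series_def hpart_def)

lemma meval_Im_series:
  assumes "mterm f (cvec x) summable_on UNIV"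
  shows "meval (Im_series f) (cvec x) = of_real (Im (meval f (cvec x)))"
proof -
  have eq: "mterm (Im_series f) (cvec x) \<alpha> = of_real (Im (mterm f (cvec x) \<alpha>))" for \<alpha>
  proof -
    have "(\<Prod>i\<in>UNIV. cvec x $ i ^ \<alpha> i) = of_real (\<Prod>i\<in>UNIV. x $ i ^ \<alpha> i)"
      by (simp add: cvec_def)
    then show ?thesis
      unfolding mterm_def Im_series_def by (simp del: of_real_prod)
  qed
  have "(mterm f (cvec x) has_sum meval f (cvec x)) UNIV"
    using assms by (simp add: meval_def)
  then have "(mterm (Im_series f) (cvec x) has_sum of_real (Im (meval f (cvec x)))) UNIV"
    unfolding eq by (intro has_sum_of_real has_sum_Im)
  then show ?thesis unfolding meval_def by (rule infsumI)
qed

lemma meval_Im_hpart: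
  "meval (Im_series (hpart k f)) (cvec x) = of_real (Im (meval (hpart k f) (cvec x)))"
  by (intro meval_Im_series has_sum_imp_summable[OF mterm_hpart_has_sum])

text \<open>Convergence at one point \<open>(r, \<dots>, r)\<close> with \<open>r > 0\<close> is absolute and dominates the terms at every
  \<open>x\<close> with \<open>\<bar>x\<^sub>i\<bar> \<le> r\<close>; continuity is then the Weierstrass M-test.\<close>

lemma conv_series_continuous_near_0:
  assumes "f \<in> conv_series"
  obtains \<rho> where "\<rho> > 0" "\<And>x. norm x < \<rho> \<Longrightarrow> mterm f x summable_on UNIV"
    "continuous_on (ball 0 \<rho>) (meval f)"
proof -
  have "((\<lambda>r. \<chi> i. complex_of_real r) \<longlongrightarrow> ((\<chi> i. complex_of_real 0) :: complex ^ 'a)) (at_right 0)"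
    by (intro tendsto_vec_lambda tendsto_of_real tendsto_ident_at)
  moreover have "((\<chi> i. complex_of_real 0) :: complex ^ 'a) = 0"
    by (simp add: vec_eq_iff)
  ultimately have "filterlim (\<lambda>r. (\<chi> i. complex_of_real r) :: complex ^ 'a) (nhds 0) (at_right 0)"
    by simp
  moreover have "\<forall>\<^sub>F x in nhds 0. mterm f x summable_on UNIV"
    using assms by (simp add: conv_series_def)
  ultimately have "\<forall>\<^sub>F r in at_right 0. mterm f (\<chi> i. complex_of_real r) summable_on UNIV"
    by (rule eventually_compose_filterlim[rotated])
  then have "\<forall>\<^sub>F r in at_right 0. mterm f (\<chi> i. complex_of_real r) summable_on UNIV \<and> r > 0"
    using eventually_at_right_less by (rule eventually_conj)
  then obtain r :: real where r: "mterm f (\<chi> i. complex_of_real r) summable_on UNIV" "r > 0"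
    using eventually_happens' trivial_limit_at_right_real by blast
  define M where "M \<alpha> = norm (mterm f (\<chi> i. complex_of_real r) \<alpha>)" for \<alpha>
  have M: "M summable_on UNIV"
    using r(1) unfolding M_def by (simp add: summable_on_iff_abs_summable_on_complex)
  have le: "norm (mterm f x \<alpha>) \<le> M \<alpha>" if "norm x < r" for x \<alpha>
  proof -
    have "norm (x $ i) \<le> r" for i
      using Finite_Cartesian_Product.norm_nth_le[of x i] that by simp
    then show ?thesis using r(2)
      unfolding M_def mterm_def norm_mult prod_norm[symmetric] norm_power
      by (intro mult_left_mono prod_mono conjI power_mono) auto
  qed
  show ?thesis
  proof (rule that[OF r(2)])
    show "mterm f x summable_on UNIV" if "norm x < r" for x
      using Infinite_Sum.abs_summable_on_comparison_test'[OF M le[OF that]]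
      by (rule abs_summable_summable)
    have "uniform_limit (ball 0 r) (\<lambda>X x. \<Sum>\<alpha>\<in>X. mterm f x \<alpha>) (\<lambda>x. \<Sum>\<^sub>\<infinity>\<alpha>. mterm f x \<alpha>)
        (finite_subsets_at_top UNIV)"
      using M by (intro Weierstrass_m_test_general[where M = M] le) auto
    then show "continuous_on (ball 0 r) (meval f)"
      unfolding meval_def
      by (rule uniform_limit_theorem[rotated])
         (auto simp: mterm_def intro!: always_eventually continuous_intros)
  qed
qed

section \<open>Leading coefficients\<close>

text \<open>After division by \<open>s\<^sup>k\<close> the series still converges, and tends to \<open>b k\<close> as \<open>s \<rightarrow> 0\<close>.\<close>

lemma leading_coeff_nonneg:
  fixes b :: "nat \<Rightarrow> real"
  assumes "\<sigma> > 0"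
    and sums: "\<And>s. \<bar>s\<bar> < \<sigma> \<Longrightarrow> (\<lambda>n. b n * s ^ n) sums B s"
    and nonneg: "\<And>s. 0 < s \<Longrightarrow> s < \<sigma> \<Longrightarrow> B s \<ge> 0"
    and zero: "\<And>j. j < k \<Longrightarrow> b j = 0"
  shows "b k \<ge> 0"
proof -
  have "(\<lambda>n. b (n + k) * s ^ n) sums (B s / s ^ k)" if "s \<noteq> 0" "norm s < \<sigma>" for s
  proof -
    have "(\<lambda>n. b (n + k) * s ^ (n + k)) sums (B s - (\<Sum>j<k. b j * s ^ j))"
      using sums that by (intro sums_split_initial_segment) auto
    then have "(\<lambda>n. b (n + k) * s ^ (n + k) / s ^ k) sums (B s / s ^ k)"
      using zero by (intro sums_divide) simp
    then show ?thesis using that by (simp add: power_add)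
  qed
  then have "((\<lambda>s. B s / s ^ k) \<longlongrightarrow> b (0 + k)) (at 0)"
    by (rule powser_limit_0_strong[OF \<open>\<sigma> > 0\<close>]) auto
  then have "((\<lambda>s. B s / s ^ k) \<longlongrightarrow> b k) (at_right 0)"
    by (simp add: filterlim_at_split)
  moreover have "\<forall>\<^sub>F s in at_right 0. B s / s ^ k \<ge> 0"
    using eventually_at_right_real[OF \<open>\<sigma> > 0\<close>] by eventually_elim (auto intro!: divide_nonneg_pos nonneg)
  ultimately show ?thesis
    by (rule tendsto_lowerbound) auto
qed

text \<open>The root with the smallest argument: \<open>Arg2pi u < 2\<pi>\<close>, so for \<open>k \<ge> 2\<close> its argument is below \<open>\<pi>\<close>.\<close>

lemma power_surj_upper_half_circle:
  assumes "norm u = 1" "k \<ge> 2"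
  obtains \<omega> :: complex where "Im \<omega> \<ge> 0" "\<omega> ^ k = u"
proof
  let ?\<theta> = "Arg2pi u / real k"
  have "0 \<le> Arg2pi u" "Arg2pi u < 2 * pi"
    using Arg2pi by auto
  moreover have "2 * pi \<le> pi * real k"
    using assms by simp
  ultimately have "Arg2pi u \<le> pi * real k"
    by linarith
  then have "0 \<le> ?\<theta>" "?\<theta> \<le> pi"
    using assms \<open>0 \<le> Arg2pi u\<close> by (simp_all add: divide_le_eq)
  then show "Im (cis ?\<theta>) \<ge> 0"
    by (simp add: sin_ge_zero)
  have "cis ?\<theta> ^ k = cis (Arg2pi u)"
    unfolding Complex.DeMoivre using assms by simp
  also have "\<dots> = u"
    using Arg2pi[of u] assms by (simp add: cis_conv_exp is_Arg_def)
  finally show "cis ?\<theta> ^ k = u" .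
qed

section \<open>Germs mapping products of half-planes to the closed half-plane\<close>

text \<open>The germs at \<open>0\<close> of Pick functions in several variables, normalised to vanish at \<open>0\<close>, with the
  inequality extended to the boundary: real points and boundary rays are where it gets used.\<close>

locale pick_germ =
  fixes \<phi> :: "'d::finite mseries" and \<rho> :: real
  assumes rho_pos: "\<rho> > 0"
    and summable: "norm x < \<rho> \<Longrightarrow> mterm \<phi> x summable_on UNIV"
    and Im_nonneg: "norm x < \<rho> \<Longrightarrow> (\<And>i. Im (x $ i) \<ge> 0) \<Longrightarrow> Im (meval \<phi> x) \<ge> 0"
    and const_zero: "\<phi> (\<lambda>_. 0) = 0"
begin

lemma line_in_ball:
  obtains \<sigma> where "\<sigma> > 0" "\<And>t :: complex. norm t < \<sigma> \<Longrightarrow> norm (t *s v :: complex ^ 'd) < \<rho>"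
proof -
  have "((\<lambda>t::complex. t *s v) \<longlongrightarrow> (\<chi> i. 0 * v $ i)) (nhds 0)"
    unfolding vector_scalar_mult_def by (intro tendsto_intros filterlim_ident)
  then have "((\<lambda>t::complex. t *s v) \<longlongrightarrow> 0) (nhds 0)"
    by (simp add: zero_vec_def)
  then have "\<forall>\<^sub>F t in nhds (0::complex). norm (t *s v) < \<rho>"
    using rho_pos by (auto simp: tendsto_iff dist_norm)
  then show ?thesis
    using that by (auto simp: eventually_nhds_metric dist_norm)
qed

lemma line_expansion:
  assumes "norm (t *s v) < \<rho>"
  shows "(\<lambda>k. meval (hpart k \<phi>) v * t ^ k) sums meval \<phi> (t *s v)"
  using homogeneous_expansion[OF summable[OF assms]] by (simp add: meval_hpart_smult mult.commute)

text \<open>The radial parameter \<open>s\<close> stays real while the direction \<open>\<omega>\<close> is complex. So the imaginary part of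
  the expansion is a real power series in \<open>s\<close>, whose terms of degree below \<open>k\<close> only need to have
  vanishing imaginary part.\<close>

lemma ray_leading_Im_nonneg:
  assumes dir: "\<And>i. Im (\<omega> * v $ i) \<ge> 0"
    and zero: "\<And>j. j < k \<Longrightarrow> Im (\<omega> ^ j * meval (hpart j \<phi>) v) = 0"
  shows "Im (\<omega> ^ k * meval (hpart k \<phi>) v) \<ge> 0"
proof -
  obtain \<sigma> where \<sigma>: "\<sigma> > 0" "\<And>t :: complex. norm t < \<sigma> \<Longrightarrow> norm (t *s (\<omega> *s v)) < \<rho>"
    using line_in_ball by blast
  show ?thesis
  proof (rule leading_coeff_nonneg[OF \<sigma>(1), where b = "\<lambda>j. Im (\<omega> ^ j * meval (hpart j \<phi>) v)"])
    fix s :: real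
    assume "\<bar>s\<bar> < \<sigma>"
    then have "(\<lambda>j. Im (meval (hpart j \<phi>) (\<omega> *s v) * of_real s ^ j)) sums Im (meval \<phi> (of_real s *s (\<omega> *s v)))"
      by (intro sums_Im line_expansion \<sigma>(2)) simp
    moreover have "Im (x * of_real c) = Im x * c" for x c
      by simp
    then have "Im (meval (hpart j \<phi>) (\<omega> *s v) * of_real s ^ j) = Im (\<omega> ^ j * meval (hpart j \<phi>) v) * s ^ j" for j
      by (simp only: meval_hpart_smult of_real_power[symmetric])
    ultimately show "(\<lambda>j. Im (\<omega> ^ j * meval (hpart j \<phi>) v) * s ^ j) sums Im (meval \<phi> (of_real s *s (\<omega> *s v)))"
      by (simp only:)
  next
    fix s :: real
    assume s: "0 < s" "s < \<sigma>"
    show "Im (meval \<phi> (of_real s *s (\<omega> *s v))) \<ge> 0"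
    proof (rule Im_nonneg)
      show "norm (of_real s *s (\<omega> *s v)) < \<rho>" using s by (intro \<sigma>(2)) simp
      show "Im ((of_real s *s (\<omega> *s v)) $ i) \<ge> 0" for i
      proof -
        have "Im (of_real s * (\<omega> * v $ i)) = s * Im (\<omega> * v $ i)"
          by (simp add: algebra_simps)
        then show ?thesis
          using s dir[of i] by (simp only: vector_smult_component) simp
      qed
    qed
  qed (fact zero)
qed

lemma cgradient_eq: "cgradient (meval \<phi>) 0 $ j = meval (hpart 1 \<phi>) (axis j 1)"
proof -
  let ?a = "\<lambda>k. meval (hpart k \<phi>) (axis j 1)"
  obtain \<sigma> where \<sigma>: "\<sigma> > 0" "\<And>t :: complex. norm t < \<sigma> \<Longrightarrow> norm (t *s (axis j 1 :: complex ^ 'd)) < \<rho>"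
    using line_in_ball by blast
  have axis: "t *s axis j 1 = (axis j t :: complex ^ 'd)" for t
    by (auto simp: vec_eq_iff axis_def)
  have "(\<lambda>n. ?a (Suc n) * t ^ n) sums (meval \<phi> (axis j t) / t)" if "t \<noteq> 0" "norm t < \<sigma>" for t
  proof -
    have "(\<lambda>k. ?a k * t ^ k) sums meval \<phi> (axis j t)"
      using line_expansion[OF \<sigma>(2)[OF that(2)]] by (simp only: axis)
    then have "(\<lambda>n. ?a (Suc n) * t ^ Suc n) sums meval \<phi> (axis j t)"
      by (subst sums_Suc_iff) (simp add: hpart_0 const_zero)
    then have "(\<lambda>n. ?a (Suc n) * t ^ Suc n / t) sums (meval \<phi> (axis j t) / t)"
      by (rule sums_divide)
    then show ?thesis using that(1) by simp
  qed
  then have "((\<lambda>t. meval \<phi> (axis j t) / t) \<longlongrightarrow> ?a (Suc 0)) (at 0)"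
    by (rule powser_limit_0_strong[OF \<sigma>(1)])
  moreover have "meval \<phi> (axis j 0) = 0"
  proof -
    have "axis j 0 = (0 :: complex ^ 'd)" by simp
    then show ?thesis by (simp only: meval_0 const_zero)
  qed
  ultimately have "((\<lambda>t. meval \<phi> (0 + axis j t)) has_field_derivative ?a 1) (at 0)"
    by (simp add: DERIV_def)
  then show ?thesis by (simp add: cgradient_def DERIV_imp_deriv)
qed

lemma gradient_nonneg: "meval (hpart 1 \<phi>) (axis j 1) \<in> \<real>\<^sub>\<ge>\<^sub>0"
proof -
  let ?a = "meval (hpart 1 \<phi>) (axis j 1)"
  have *: "Im (\<omega> * ?a) \<ge> 0" if "Im \<omega> \<ge> 0" for \<omega>
    using that ray_leading_Im_nonneg[where k = 1 and v = "axis j 1" and \<omega> = \<omega>]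
    by (auto simp: hpart_0 const_zero axis_def)
  from *[of 1] *[of "-1"] *[of \<i>] show ?thesis
    by (auto simp: complex_nonneg_Reals_iff)
qed

text \<open>Since \<open>v\<close> has nonnegative entries, every \<open>\<omega>\<close> of the closed upper half-plane is an admissible
  direction, and for \<open>k \<ge> 2\<close> the powers \<open>\<omega>\<^sup>k\<close> rotate the leading term into the lower half-plane.\<close>

lemma homogeneous_parts_real_nonneg_vanish:
  assumes v: "\<And>i. v $ i \<ge> 0" and lin: "meval (hpart 1 \<phi>) (cvec v) = 0"
  shows "meval (hpart k \<phi>) (cvec v) = 0"
proof (induction k rule: less_induct)
  case (less k)
  let ?a = "meval (hpart k \<phi>) (cvec v)"
  consider "k = 0" | "k = 1" | "k \<ge> 2" by linarith
  then show ?case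
  proof cases
    case 1
    then show ?thesis by (simp add: hpart_0 const_zero)
  next
    case 2
    then show ?thesis using lin by simp
  next
    case 3
    show ?thesis
    proof (rule ccontr)
      assume "?a \<noteq> 0"
      \<comment> \<open>The target of \<open>\<omega>\<^sup>k\<close> rotates \<open>?a\<close> to the negative imaginary axis.\<close>
      obtain \<omega> where \<omega>: "Im \<omega> \<ge> 0" "\<omega> ^ k = - \<i> * cnj (sgn ?a)"
        using power_surj_upper_half_circle[of "- \<i> * cnj (sgn ?a)" k] 3 \<open>?a \<noteq> 0\<close>
        by (auto simp: norm_mult norm_sgn)
      have "Im (\<omega> ^ k * ?a) \<ge> 0"
        using \<omega>(1) v less.IH by (intro ray_leading_Im_nonneg) (auto simp: cvec_def)
      moreover have "\<omega> ^ k * ?a = - \<i> * of_real (norm ?a)"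
      proof -
        have "cnj (sgn ?a) * ?a = of_real (norm ?a)"
          using \<open>?a \<noteq> 0\<close> by (simp add: sgn_eq complex_norm_square[symmetric] power2_eq_square mult.commute)
        then show ?thesis by (simp add: \<omega>(2) mult.assoc)
      qed
      ultimately show False using \<open>?a \<noteq> 0\<close> by simp
    qed
  qed
qed

text \<open>The linear part restricted to \<open>T\<close> vanishes because its coefficients are the partial derivatives
  in \<open>grad\<close>; this starts the induction of \<open>homogeneous_parts_real_nonneg_vanish\<close>.\<close>

lemma coeffs_zero_on_gradient_kernel:
  assumes grad: "\<And>j. j \<in> T \<Longrightarrow> meval (hpart 1 \<phi>) (axis j 1) = 0"
    and \<alpha>: "\<And>i. i \<notin> T \<Longrightarrow> \<alpha> i = 0"
  shows "\<phi> \<alpha> = 0"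
proof (rule poly_vanishing_on_orthant[OF finite_mdeg_eq _ _ \<alpha>])
  show "\<alpha> \<in> {\<beta>. mdeg \<beta> = mdeg \<alpha>}" by simp
next
  fix x :: "real ^ 'd"
  assume x: "\<forall>i. if i \<in> T then x $ i > 0 else x $ i = 0"
  have lin: "mterm \<phi> (cvec x) \<beta> = 0" if deg: "mdeg \<beta> = 1" for \<beta>
  proof -
    obtain j where j: "\<beta> j = 1" "\<And>i. i \<noteq> j \<Longrightarrow> \<beta> i = 0"
      using deg sum_eq_Suc0_iff[of UNIV \<beta>] by auto
    show ?thesis
    proof (cases "j \<in> T")
      case True
      have "\<phi> \<beta> = 0"
      proof (rule poly_vanishing_on_orthant[OF finite_mdeg_eq, where S = "{j}"])
        show "\<beta> \<in> {\<beta>. mdeg \<beta> = 1}" using deg by simp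
        show "\<beta> i = 0" if "i \<notin> {j}" for i using that j by simp
        fix y :: "real ^ 'd"
        assume "\<forall>i. if i \<in> {j} then y $ i > 0 else y $ i = 0"
        then have "cvec y = of_real (y $ j) *s axis j 1"
          by (auto simp: vec_eq_iff cvec_def axis_def)
        then show "(\<Sum>\<beta> | mdeg \<beta> = 1. mterm \<phi> (cvec y) \<beta>) = 0"
          using grad[OF True] meval_hpart_smult[of 1 \<phi> "of_real (y $ j)" "axis j 1"]
          by (simp add: meval_hpart)
      qed
      then show ?thesis by (simp add: mterm_def)
    next
      case False
      then have "(\<Prod>i\<in>UNIV. cvec x $ i ^ \<beta> i) = 0"
        using x j by (intro prod_zero) (auto simp: cvec_def intro!: exI[of _ j])
      then show ?thesis by (simp add: mterm_def)
    qed
  qed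
  have "meval (hpart (mdeg \<alpha>) \<phi>) (cvec x) = 0"
  proof (rule homogeneous_parts_real_nonneg_vanish)
    show "x $ i \<ge> 0" for i using x[rule_format, of i] by (auto split: if_splits)
    show "meval (hpart 1 \<phi>) (cvec x) = 0"
      using lin by (simp add: meval_hpart)
  qed
  then show "(\<Sum>\<beta> | mdeg \<beta> = mdeg \<alpha>. mterm \<phi> (cvec x) \<beta>) = 0"
    by (simp add: meval_hpart)
qed

lemma vanishes_on_gradient_kernel:
  assumes "\<And>j. j \<in> T \<Longrightarrow> meval (hpart 1 \<phi>) (axis j 1) = 0"
  shows "meval \<phi> (\<Sum>j\<in>T. axis j (x $ j)) = 0"
proof -
  let ?y = "\<Sum>j\<in>T. axis j (x $ j)"
  have "mterm \<phi> ?y \<alpha> = 0" for \<alpha>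
  proof (cases "\<forall>i. i \<notin> T \<longrightarrow> \<alpha> i = 0")
    case True
    then show ?thesis
      using coeffs_zero_on_gradient_kernel[of T \<alpha>] assms by (simp add: mterm_def)
  next
    case False
    then obtain i where i: "i \<notin> T" "\<alpha> i \<noteq> 0" by blast
    then have "?y $ i = 0"
      by (auto simp: axis_def intro!: sum.neutral)
    then have "(\<Prod>i\<in>UNIV. ?y $ i ^ \<alpha> i) = 0"
      using i by (intro prod_zero) (auto intro!: exI[of _ i] simp del: sum_component)
    then show ?thesis by (simp add: mterm_def)
  qed
  then show ?thesis by (simp add: meval_def)
qed

lemma Im_series_nonneg: "\<forall>\<^sub>F x in nhds (0 :: real ^ 'd). meval (Im_series \<phi>) (cvec x) \<in> \<real>\<^sub>\<ge>\<^sub>0"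
proof -
  have "norm (cvec x) = norm x" for x :: "real ^ 'd"
    by (simp add: norm_vec_def cvec_def)
  moreover have "\<forall>\<^sub>F x in nhds (0 :: real ^ 'd). norm x < \<rho>"
    using rho_pos by (auto simp: eventually_nhds_metric dist_norm)
  ultimately show ?thesis
    by (auto elim!: eventually_mono simp: meval_Im_series[OF summable] intro!: Im_nonneg)
       (simp add: cvec_def)
qed

text \<open>On real points both directions \<open>\<omega> = 1\<close> and \<open>\<omega> = -1\<close> are admissible. They give the sign of the
  first nonreal part and exclude odd degrees, where the two inequalities are opposite.\<close>

lemma first_nonreal_part:
  assumes "\<not> (\<forall>\<alpha>. \<phi> \<alpha> \<in> \<real>)"
  obtains L where "L \<ge> 1" "\<And>j \<alpha>. j < 2 * L \<Longrightarrow> hpart j \<phi> \<alpha> \<in> \<real>"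
    "\<And>x. Im (meval (hpart (2 * L) \<phi>) (cvec x)) \<ge> 0"
    "\<exists>x. Im (meval (hpart (2 * L) \<phi>) (cvec x)) \<noteq> 0"
proof -
  define m where "m = (LEAST m. \<exists>\<alpha>. mdeg \<alpha> = m \<and> \<phi> \<alpha> \<notin> \<real>)"
  have "\<exists>m \<alpha>. mdeg \<alpha> = m \<and> \<phi> \<alpha> \<notin> \<real>" using assms by blast
  then have "\<exists>\<alpha>. mdeg \<alpha> = m \<and> \<phi> \<alpha> \<notin> \<real>"
    unfolding m_def by (rule LeastI_ex)
  then obtain \<alpha> where \<alpha>: "mdeg \<alpha> = m" "\<phi> \<alpha> \<notin> \<real>" by blast
  have real: "hpart j \<phi> \<beta> \<in> \<real>" if "j < m" for j \<beta>
  proof (rule ccontr)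
    assume "hpart j \<phi> \<beta> \<notin> \<real>"
    then have "\<exists>\<alpha>. mdeg \<alpha> = j \<and> \<phi> \<alpha> \<notin> \<real>"
      unfolding hpart_def by (metis Reals_0)
    then have "m \<le> j" unfolding m_def by (rule Least_le)
    with that show False by simp
  qed
  have Im0: "Im (meval (hpart j \<phi>) (cvec x)) = 0" if "j < m" for j x
  proof -
    have "Im_series (hpart j \<phi>) = (\<lambda>_. 0)"
      using real[OF that] by (auto simp: Im_series_def complex_is_Real_iff)
    then show ?thesis
      using meval_Im_hpart[of j \<phi> x] by (simp add: meval_def mterm_def)
  qed
  have sgn: "Im (\<omega> ^ m * meval (hpart m \<phi>) (cvec x)) \<ge> 0" if "\<omega> = 1 \<or> \<omega> = -1" for \<omega> x
  proof (rule ray_leading_Im_nonneg)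
    show "Im (\<omega> * cvec x $ i) \<ge> 0" for i using that by (auto simp: cvec_def)
    show "Im (\<omega> ^ j * meval (hpart j \<phi>) (cvec x)) = 0" if "j < m" for j
      using Im0[OF that, of x] \<open>\<omega> = 1 \<or> \<omega> = -1\<close> by (cases "even j") auto
  qed
  have nz: "\<exists>x. Im (meval (hpart m \<phi>) (cvec x)) \<noteq> 0"
  proof (rule ccontr)
    assume "\<not> ?thesis"
    then have "meval (hpart m (Im_series \<phi>)) (cvec x) = 0" for x
      using meval_Im_hpart[of m \<phi> x] by (simp add: Im_series_hpart)
    then have "Im_series \<phi> \<alpha> = 0"
      using \<alpha>(1)
      by (intro poly_vanishing_on_orthant[OF finite_mdeg_eq[of m], where c = "Im_series \<phi>" and S = UNIV])
         (simp_all add: meval_hpart)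
    then show False using \<alpha>(2) by (simp add: Im_series_def complex_is_Real_iff)
  qed
  have "even m"
  proof (rule ccontr)
    assume "odd m"
    then have "Im (meval (hpart m \<phi>) (cvec x)) = 0" for x
      using sgn[of 1 x] sgn[of "-1" x] by simp
    then show False using nz by blast
  qed
  then obtain L where L: "m = 2 * L" by blast
  have "m \<noteq> 0"
  proof
    assume "m = 0"
    then have "\<alpha> = (\<lambda>_. 0)" using \<alpha>(1) by auto
    then show False using \<alpha>(2) const_zero by simp
  qed
  then show ?thesis
    using sgn[of 1] nz real by (intro that[of L]) (auto simp: L)
qed

end

text \<open>A point \<open>x\<close> of the closure of \<open>\<H>\<^sup>d\<close> is the limit of \<open>x + \<i>\<epsilon>(1, \<dots>, 1) \<in> \<H>\<^sup>d\<close> as \<open>\<epsilon>\<close> decreases to \<open>0\<close>. The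
  radius must keep \<open>\<phi>(x)\<close> below \<open>\<delta>\<close> in norm, so that \<open>z = -\<phi>(x)\<close> is covered by the hypothesis.\<close>

lemma pick_germ_of_zero_free:
  fixes \<phi> :: "'d::finite mseries"
  assumes conv: "\<phi> \<in> conv_series" and zero: "meval \<phi> 0 = 0" and "\<delta> > 0"
    and zero_free: "\<And>z x. z \<in> upper_half_plane \<Longrightarrow> (\<And>j. x $ j \<in> upper_half_plane) \<Longrightarrow>
           norm z < \<delta> \<Longrightarrow> norm x < \<delta> \<Longrightarrow> z + meval \<phi> x \<noteq> 0"
  obtains \<rho> where "pick_germ \<phi> \<rho>"
proof -
  obtain r where r: "r > 0" "\<And>x. norm x < r \<Longrightarrow> mterm \<phi> x summable_on UNIV"
    and cont: "continuous_on (ball 0 r) (meval \<phi>)"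
    using conv_series_continuous_near_0[OF conv] by blast
  have lim: "(meval \<phi> \<longlongrightarrow> meval \<phi> x) (at x)" if "norm x < r" for x
    using cont that by (simp add: continuous_on_eq_continuous_at isCont_def)
  obtain \<eta> where \<eta>: "\<eta> > 0" "\<And>x. norm x < \<eta> \<Longrightarrow> norm (meval \<phi> x) < \<delta>"
  proof -
    have "continuous (at 0) (meval \<phi>)"
      using cont r by (simp add: continuous_on_eq_continuous_at)
    then have "\<exists>d>0. \<forall>x. dist x 0 < d \<longrightarrow> dist (meval \<phi> x) (meval \<phi> 0) < \<delta>"
      using \<open>\<delta> > 0\<close> by (auto simp: continuous_at_eps_delta dist_norm)
    then show ?thesis using that by (auto simp: zero dist_norm)
  qed
  define \<rho> where "\<rho> = Min {r, \<eta>, \<delta>}"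
  have \<rho>: "\<rho> > 0" "\<rho> \<le> r" "\<rho> \<le> \<eta>" "\<rho> \<le> \<delta>"
    using r \<eta> \<open>\<delta> > 0\<close> by (auto simp: \<rho>_def)
  have open_case: "Im (meval \<phi> x) \<ge> 0" if "norm x < \<rho>" "\<And>i. Im (x $ i) > 0" for x
  proof (rule ccontr)
    assume "\<not> ?thesis"
    then have "- meval \<phi> x + meval \<phi> x \<noteq> 0"
      using that \<rho> \<eta>(2)[of x] by (intro zero_free) (auto simp: upper_half_plane_def)
    then show False by simp
  qed
  have "Im (meval \<phi> x) \<ge> 0" if x: "norm x < \<rho>" "\<And>i. Im (x $ i) \<ge> 0" for x
  proof -
    define y where "y \<epsilon> = (\<chi> i. x $ i + \<i> * complex_of_real \<epsilon>)" for \<epsilon>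
    have "(y \<longlongrightarrow> (\<chi> i. x $ i + \<i> * complex_of_real 0)) (at_right 0)"
      unfolding y_def by (intro tendsto_intros)
    then have y: "(y \<longlongrightarrow> x) (at_right 0)" by simp
    have "((\<lambda>\<epsilon>. Im (meval \<phi> (y \<epsilon>))) \<longlongrightarrow> Im (meval \<phi> x)) (at_right 0)"
      using lim[of x] x \<rho> y by (intro tendsto_Im) (auto intro: tendsto_compose)
    moreover have "\<forall>\<^sub>F \<epsilon> in at_right 0. Im (meval \<phi> (y \<epsilon>)) \<ge> 0"
    proof -
      have "\<forall>\<^sub>F \<epsilon> in at_right 0. norm (y \<epsilon>) < \<rho>"
        using tendsto_norm[OF y] x(1) by (rule order_tendstoD)
      moreover have "\<forall>\<^sub>F \<epsilon> in at_right (0::real). \<epsilon> > 0"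
        by (rule eventually_at_right_less)
      ultimately show ?thesis
        by eventually_elim (intro open_case, use x(2) in \<open>auto simp: y_def add_nonneg_pos\<close>)
    qed
    ultimately show ?thesis by (rule tendsto_lowerbound) auto
  qed
  then have "pick_germ \<phi> \<rho>"
    using \<rho> r zero by unfold_locales (auto simp: meval_0)
  then show ?thesis by (rule that)
qed

theorem proposition1p2:
  fixes \<phi> :: "'d::finite mseries"
  assumes "\<phi> \<in> conv_series"
    and "meval \<phi> 0 = 0"
    and "\<exists>\<delta>>0. \<forall>z\<in>upper_half_plane. \<forall>x. (\<forall>j. x $ j \<in> upper_half_plane) \<longrightarrow>
           norm z < \<delta> \<longrightarrow> norm x < \<delta> \<longrightarrow> z + meval \<phi> x \<noteq> 0"
  shows "(\<forall>j. cgradient (meval \<phi>) 0 $ j \<in> \<real>\<^sub>\<ge>\<^sub>0)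
    \<and> (\<forall>\<^sub>F x in nhds (0 :: real ^ 'd). meval (Im_series \<phi>) (cvec x) \<in> \<real>\<^sub>\<ge>\<^sub>0)
    \<and> (\<phi> \<in> real_conv_series
       \<or> (\<exists>L\<ge>1. \<exists>P :: nat \<Rightarrow> 'd mseries.
            (\<forall>j\<ge>1. P j \<in> homogeneous_polys j)
          \<and> (\<forall>\<^sub>F x in nhds 0. (\<lambda>j. meval (P (Suc j)) x) sums meval \<phi> x)
          \<and> (\<forall>j\<in>{1..2 * L - 1}. P j \<in> real_polys)
          \<and> (\<exists>x :: real ^ 'd. meval (Im_series (P (2 * L))) (cvec x) \<noteq> 0)
          \<and> (\<forall>x :: real ^ 'd. meval (Im_series (P (2 * L))) (cvec x) \<in> \<real>\<^sub>\<ge>\<^sub>0)))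
    \<and> (let T = {j. cgradient (meval \<phi>) 0 $ j = 0} in
         \<forall>\<^sub>F x in nhds (0 :: complex ^ 'd). meval \<phi> (\<Sum>j\<in>T. axis j (x $ j)) = 0)"
proof -
  obtain \<rho> where "pick_germ \<phi> \<rho>"
    using assms pick_germ_of_zero_free by metis
  then interpret pick_germ \<phi> \<rho> .
  have "\<exists>L\<ge>1. \<exists>P :: nat \<Rightarrow> 'd mseries.
            (\<forall>j\<ge>1. P j \<in> homogeneous_polys j)
          \<and> (\<forall>\<^sub>F x in nhds 0. (\<lambda>j. meval (P (Suc j)) x) sums meval \<phi> x)
          \<and> (\<forall>j\<in>{1..2 * L - 1}. P j \<in> real_polys)
          \<and> (\<exists>x :: real ^ 'd. meval (Im_series (P (2 * L))) (cvec x) \<noteq> 0)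
          \<and> (\<forall>x :: real ^ 'd. meval (Im_series (P (2 * L))) (cvec x) \<in> \<real>\<^sub>\<ge>\<^sub>0)"
    if "\<phi> \<notin> real_conv_series"
  proof -
    have "\<not> (\<forall>\<alpha>. \<phi> \<alpha> \<in> \<real>)"
      using that assms(1) by (simp add: real_conv_series_def)
    then obtain L where L: "L \<ge> 1" "\<And>j \<alpha>. j < 2 * L \<Longrightarrow> hpart j \<phi> \<alpha> \<in> \<real>"
      "\<And>x. Im (meval (hpart (2 * L) \<phi>) (cvec x)) \<ge> 0"
      "\<exists>x. Im (meval (hpart (2 * L) \<phi>) (cvec x)) \<noteq> 0"
      by (rule first_nonreal_part) blast
    have "\<forall>\<^sub>F x in nhds 0. (\<lambda>j. meval (hpart (Suc j) \<phi>) x) sums meval \<phi> x"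
    proof -
      have "\<forall>\<^sub>F x in nhds 0. mterm \<phi> x summable_on UNIV"
        using assms(1) by (simp add: conv_series_def)
      then show ?thesis
      proof eventually_elim
        case (elim x)
        show ?case
          using homogeneous_expansion[OF elim] by (subst sums_Suc_iff) (simp add: hpart_0 const_zero)
      qed
    qed
    moreover have "hpart j \<phi> \<in> real_polys" if "j < 2 * L" for j
      using L(2)[OF that] hpart_homogeneous[of j \<phi>]
      by (simp add: real_polys_def homogeneous_polys_def)
    ultimately show ?thesis
      using L
      by (intro exI[of _ L] conjI exI[of _ "\<lambda>j. hpart j \<phi>"])
         (auto simp: hpart_homogeneous meval_Im_hpart)
  qed
  moreover have "meval \<phi> (\<Sum>j | cgradient (meval \<phi>) 0 $ j = 0. axis j (x $ j)) = 0" for x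
    by (rule vanishes_on_gradient_kernel) (simp add: cgradient_eq)
  ultimately show ?thesis
    using gradient_nonneg Im_series_nonneg by (auto simp: Let_def cgradient_eq)
qed

end
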